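(* Let $U$ be a finite set and let $v:2^U\to\mathbb{R}_{\ge0}$ be a non-negative monotone submodular (respectively XOS, subadditive) set function. Then, for any $B\in\mathbb{R}_{\ge0}$, the function $\bar v=\min\{v,B\}$, i.e. $\bar v(S)=\min\{v(S),B\}$ for $S\subseteq U$, is also monotone submodular (respectively XOS, subadditive).
   Context: $v$ is monotone if $v(S)\le v(T)$ for all $S\subseteq T\subseteq U$; valuations are normalized, $v(\emptyset)=0$. $v$ is submodular if $v(S)+v(T)\ge v(S\cap T)+v(S\cup T)$ for all $S,T\subseteq U$; subadditive if $v(S)+v(T)\ge v(S\cup T)$ for all $S,T\subseteq U$; XOS if there exist (finitely many) additive functions $w_k:2^U\to\mathbb{R}_{\ge0}$ such that $v(S)=\max_k w_k(S)$ for every $S\subseteq U$. *)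

theory Defs
  imports "HOL-Analysis.Analysis"
begin

text \<open>
  A set function on a ground set \<open>U\<close> is a function \<open>'a set \<Rightarrow> real\<close> of which only the values
  on subsets of \<open>U\<close> matter. Monotonicity is \<^term>\<open>mono_on (Pow U) v\<close>.
\<close>

definition nonneg_on_subsets :: "'a set \<Rightarrow> ('a set \<Rightarrow> real) \<Rightarrow> bool" where
  "nonneg_on_subsets U v \<longleftrightarrow> (\<forall>S\<subseteq>U. 0 \<le> v S)"

definition submodular_on :: "'a set \<Rightarrow> ('a set \<Rightarrow> real) \<Rightarrow> bool" where
  "submodular_on U v \<longleftrightarrow> (\<forall>S\<subseteq>U. \<forall>T\<subseteq>U. v S + v T \<ge> v (S \<inter> T) + v (S \<union> T))"

text \<open>
  Unlike the library's \<^const>\<open>subadditive\<close>, which only considers disjoint sets, this ranges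
  over all pairs of subsets.
\<close>

definition subadditive_on :: "'a set \<Rightarrow> ('a set \<Rightarrow> real) \<Rightarrow> bool" where
  "subadditive_on U v \<longleftrightarrow> (\<forall>S\<subseteq>U. \<forall>T\<subseteq>U. v S + v T \<ge> v (S \<union> T))"

text \<open>
  \<^const>\<open>additive\<close> is finite additivity on disjoint sets; for real-valued functions it forces
  the value \<open>0\<close> on the empty set.
\<close>

definition xos_on :: "'a set \<Rightarrow> ('a set \<Rightarrow> real) \<Rightarrow> bool" where
  "xos_on U v \<longleftrightarrow>
     (\<exists>W. finite W \<and> W \<noteq> {} \<and>
        (\<forall>w\<in>W. additive (Pow U) w \<and> nonneg_on_subsets U w) \<and>
        (\<forall>S\<subseteq>U. v S = Max ((\<lambda>w. w S) ` W)))"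

definition truncation :: "('a set \<Rightarrow> real) \<Rightarrow> real \<Rightarrow> 'a set \<Rightarrow> real" where
  "truncation v B S = min (v S) B"

end

(* Submodularity (with monotonicity) and subadditivity (with nonnegativity) survive truncation by
   comparing the values with B. For XOS, each A \<subseteq> U receives the supporting additive function
   S \<mapsto> c * w (S \<inter> A), where w attains v A and c = min (v A) B / v A: it attains min (v A) B at A,
   is dominated by w \<le> v because c \<le> 1, and is bounded by its value at A, hence by B. *)

theory Submission
  imports Defs
begin

text \<open>If \<open>v S\<close> or \<open>v T\<close> reaches \<open>B\<close>, that term alone
  covers the truncated union, and the other term covers the truncated intersection by monotonicity.
  If both stay below \<open>B\<close>, the left side is untouched and truncation can only lower the
  right side.\<close>

lemma submodular_on_truncation:
  assumes "mono_on (Pow U) v" "submodular_on U v"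
  shows "submodular_on U (truncation v B)"
  unfolding submodular_on_def truncation_def
proof (intro allI impI)
  fix S T assume ST: "S \<subseteq> U" "T \<subseteq> U"
  have "v (S \<inter> T) \<le> v S" "v (S \<inter> T) \<le> v T" "v S \<le> v (S \<union> T)" "v T \<le> v (S \<union> T)"
    using ST by (auto intro!: mono_onD[OF assms(1)])
  moreover have "v S + v T \<ge> v (S \<inter> T) + v (S \<union> T)"
    using assms(2) ST by (auto simp: submodular_on_def)
  ultimately show "min (v S) B + min (v T) B \<ge> min (v (S \<inter> T)) B + min (v (S \<union> T)) B"
    by linarith
qed

text \<open>A summand that reaches \<open>B\<close> suffices on its own, since the other truncated
  value is nonnegative. Otherwise neither summand is cut.\<close>

lemma subadditive_on_truncation:
  assumes "nonneg_on_subsets U v" "subadditive_on U v" "B \<ge> 0"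
  shows "subadditive_on U (truncation v B)"
  unfolding subadditive_on_def truncation_def
proof (intro allI impI)
  fix S T assume ST: "S \<subseteq> U" "T \<subseteq> U"
  have "0 \<le> v S" "0 \<le> v T" "v S + v T \<ge> v (S \<union> T)"
    using assms ST by (auto simp: nonneg_on_subsets_def subadditive_on_def)
  with \<open>B \<ge> 0\<close> show "min (v S) B + min (v T) B \<ge> min (v (S \<union> T)) B"
    by linarith
qed

text \<open>Used to compare the value at \<open>S \<inter> A\<close> with the values at both
  \<open>S\<close> and \<open>A\<close>.\<close>

lemma additive_nonneg_mono:
  assumes "additive (Pow U) w" "nonneg_on_subsets U w"
  shows "mono_on (Pow U) w"
proof (rule mono_onI)
  fix S T assume ST: "S \<in> Pow U" "T \<in> Pow U" "S \<subseteq> T"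
  then have "w (S \<union> (T - S)) = w S + w (T - S)"
    by (intro additiveD[OF assms(1)]) auto
  moreover have "0 \<le> w (T - S)"
    using assms(2) ST unfolding nonneg_on_subsets_def by blast
  moreover have "S \<union> (T - S) = T"
    using ST by auto
  ultimately show "w S \<le> w T" by simp
qed

text \<open>A maximum over a finite nonempty family is attained, so some member of the family
  supports \<open>v\<close> at \<open>A\<close>. With the converse \<open>xos_onI\<close>, XOS
  becomes a condition on one set at a time.\<close>

lemma xos_onE:
  assumes "xos_on U v" "A \<subseteq> U"
  obtains w where "additive (Pow U) w" "nonneg_on_subsets U w" "w A = v A"
    "\<And>S. S \<subseteq> U \<Longrightarrow> w S \<le> v S"
proof -
  obtain W where W: "finite W" "W \<noteq> {}"
    "\<And>w. w \<in> W \<Longrightarrow> additive (Pow U) w \<and> nonneg_on_subsets U w"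
    "\<And>S. S \<subseteq> U \<Longrightarrow> v S = Max ((\<lambda>w. w S) ` W)"
    using assms(1) by (auto simp: xos_on_def)
  have "v A \<in> (\<lambda>w. w A) ` W"
    using W assms(2) by (simp add: Max_in)
  then obtain w where "w \<in> W" "w A = v A" by auto
  moreover from this have "w S \<le> v S" if "S \<subseteq> U" for S
    using W that by simp
  ultimately show thesis using that W(3) by blast
qed

text \<open>Choosing one supporting function per subset gives a family indexed by
  \<open>Pow U\<close>, hence finite and nonempty. At \<open>S\<close> the function chosen for
  \<open>S\<close> attains \<open>v S\<close> and no other exceeds it.\<close>

lemma xos_onI:
  assumes "finite U"
    and "\<And>A. A \<subseteq> U \<Longrightarrow> \<exists>w. additive (Pow U) w \<and> nonneg_on_subsets U w \<and> w A = v A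
           \<and> (\<forall>S\<subseteq>U. w S \<le> v S)"
  shows "xos_on U v"
proof -
  obtain f where f: "\<And>A. A \<subseteq> U \<Longrightarrow> additive (Pow U) (f A) \<and> nonneg_on_subsets U (f A)
      \<and> f A A = v A \<and> (\<forall>S\<subseteq>U. f A S \<le> v S)"
    using assms(2) by metis
  have "v S = Max ((\<lambda>w. w S) ` f ` Pow U)" if "S \<subseteq> U" for S
  proof (rule Max_eqI[symmetric])
    show "v S \<in> (\<lambda>w. w S) ` f ` Pow U"
      using f[OF that] that by (metis PowI imageI)
  qed (use assms(1) f that in auto)
  then show ?thesis
    unfolding xos_on_def using assms(1) f by (intro exI[of _ "f ` Pow U"]) auto
qed

lemma xos_on_truncation:
  assumes "finite U" "nonneg_on_subsets U v" "xos_on U v" "B \<ge> 0"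
  shows "xos_on U (truncation v B)"
proof (rule xos_onI[OF assms(1)])
  fix A assume A: "A \<subseteq> U"
  obtain w where w: "additive (Pow U) w" "nonneg_on_subsets U w" "w A = v A"
    "\<And>S. S \<subseteq> U \<Longrightarrow> w S \<le> v S"
    using xos_onE[OF assms(3) A] by blast
  \<comment> \<open>If \<open>v A = 0\<close>, division by zero gives \<open>c = 0\<close>, which is still a valid scaling factor.\<close>
  define c where "c = min (v A) B / v A"
  have vA: "0 \<le> v A" using assms(2) A by (simp add: nonneg_on_subsets_def)
  have c: "0 \<le> c" "c \<le> 1" "c * v A = min (v A) B"
    using vA \<open>B \<ge> 0\<close> by (auto simp: c_def divide_le_eq_1)
  have mono: "w S \<le> w T" if "S \<subseteq> T" "T \<subseteq> U" for S T
    using mono_onD[OF additive_nonneg_mono[OF w(1,2)]] that by auto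
  have nn: "0 \<le> w S" if "S \<subseteq> U" for S
    using w(2) that by (simp add: nonneg_on_subsets_def)
  let ?u = "\<lambda>S. c * w (S \<inter> A)"
  have "additive (Pow U) ?u"
    unfolding additive_def
  proof (intro ballI impI)
    fix S T assume ST: "S \<in> Pow U" "T \<in> Pow U" "S \<inter> T = {}"
    then have "w ((S \<inter> A) \<union> (T \<inter> A)) = w (S \<inter> A) + w (T \<inter> A)"
      by (intro additiveD[OF w(1)]) auto
    then show "c * w ((S \<union> T) \<inter> A) = c * w (S \<inter> A) + c * w (T \<inter> A)"
      by (simp add: Int_Un_distrib2 distrib_left)
  qed
  moreover have "nonneg_on_subsets U ?u"
    using c(1) by (simp add: nonneg_on_subsets_def nn le_infI1)
  moreover have "?u A = truncation v B A"
    using c w(3) by (simp add: truncation_def)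
  moreover have "?u S \<le> truncation v B S" if S: "S \<subseteq> U" for S
  proof -
    have "?u S \<le> w (S \<inter> A)"
      using c nn[of "S \<inter> A"] S by (intro mult_left_le_one_le) auto
    also have "\<dots> \<le> v S"
      using mono[of "S \<inter> A" S] w(4)[OF S] S by auto
    finally have "?u S \<le> v S" .
    \<comment> \<open>This bound supplies the cap: \<open>c * v A\<close> equals
      \<open>min (v A) B\<close>, which is at most \<open>B\<close>.\<close>
    moreover have "?u S \<le> c * v A"
      using mono[of "S \<inter> A" A] w(3) A c by (intro mult_left_mono) auto
    ultimately show ?thesis
      using c(3) by (simp add: truncation_def)
  qed
  ultimately show "\<exists>u. additive (Pow U) u \<and> nonneg_on_subsets U u \<and> u A = truncation v B A
      \<and> (\<forall>S\<subseteq>U. u S \<le> truncation v B S)"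
    by blast
qed

theorem lemma3p1:
  fixes U :: "'a set" and v :: "'a set \<Rightarrow> real" and B :: real
  assumes "finite U"
    and "nonneg_on_subsets U v"
    and "mono_on (Pow U) v"
    and "B \<ge> 0"
  shows "nonneg_on_subsets U (truncation v B)
    \<and> (v {} = 0 \<longrightarrow> truncation v B {} = 0)
    \<and> mono_on (Pow U) (truncation v B)
    \<and> (submodular_on U v \<longrightarrow> submodular_on U (truncation v B))
    \<and> (xos_on U v \<longrightarrow> xos_on U (truncation v B))
    \<and> (subadditive_on U v \<longrightarrow> subadditive_on U (truncation v B))"
proof (intro conjI impI)
  show "nonneg_on_subsets U (truncation v B)"
    using assms by (simp add: nonneg_on_subsets_def truncation_def)
  show "truncation v B {} = 0" if "v {} = 0"
    using that assms by (simp add: truncation_def)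
  show "mono_on (Pow U) (truncation v B)"
    using assms(3) unfolding truncation_def monotone_on_def by (meson min.mono order_refl)
qed (use assms in \<open>auto intro: submodular_on_truncation xos_on_truncation
       subadditive_on_truncation\<close>)

end
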